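(* Let $U:\mathcal{E}\to\mathcal{B}$ be a Lawvere category with truth functor $K$, let $I$ be an object of $\mathcal{B}$, and let $F:\mathcal{B}/I\to\mathcal{B}/I$ be a functor whose initial algebra has carrier $\mu F$. Then there exists a truth-preserving lifting of $F$ with respect to the fibration $U/I:\mathcal{E}/KI\to\mathcal{B}/I$ which defines a sound induction rule for $\mu F$.
   Context: Fibrations, opfibrations, bifibrations, fibres and reindexing are as usual: for $U:\mathcal{E}\to\mathcal{B}$, a morphism $g:Q\to P$ is cartesian above $f$ if $Ug=f$ and every $g':Q'\to P$ with $Ug'=fv$ factors uniquely as $g h$ with $Uh=v$; $U$ is a fibration if cartesian morphisms above any $f:X\to UP$ with codomain $P$ exist; an opfibration is the dual notion, a bifibration is both. $U$ has a truth functor if each fibre $\mathcal{E}_X$ has a terminal object preserved by reindexing; the truth functor $K:\mathcal{B}\to\mathcal{E}$ sends $X$ to it. A comprehension category with unit (CCU) is a fibration with a truth functor $K$ having a right adjoint (the comprehension functor). A Lawvere category is a CCU that is also a bifibration. The functor $U/I:\mathcal{E}/KI\to\mathcal{B}/I$ sends an object $f:P\to KI$ of the slice $\mathcal{E}/KI$ to $Uf:UP\to I$ (note $UKI=I$), and acts likewise on morphisms; it is a fibration with truth functor $K_{U/I}$ sending $f:X\to I$ to $Kf:KX\to KI$. For a fibration $V:\mathcal{D}\to\mathcal{C}$ with truth functor $K_V$ and a functor $G:\mathcal{C}\to\mathcal{C}$ with an initial algebra with carrier $\mu G$, a truth-preserving lifting of $G$ is a functor $\hat G:\mathcal{D}\to\mathcal{D}$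 with $V\hat G=GV$ and $K_V G\cong \hat G K_V$; it defines a sound induction rule for $\mu G$ if the functor from $G$-algebras to $\hat G$-algebras sending $\alpha:GX\to X$ to $\hat G K_V X\cong K_V G X\xrightarrow{K_V\alpha}K_V X$ preserves initial objects. *)

theory Defs
  imports Main
begin

text \<open>Composition is written in the usual order: Comp C g f is g after f.\<close>

record ('o, 'm) cat =
  Ob :: "'o set"
  Ar :: "'m set"
  Dom :: "'m \<Rightarrow> 'o"
  Cod :: "'m \<Rightarrow> 'o"
  Ident :: "'o \<Rightarrow> 'm"
  Comp :: "'m \<Rightarrow> 'm \<Rightarrow> 'm"

definition hom :: "('o, 'm) cat \<Rightarrow> 'o \<Rightarrow> 'o \<Rightarrow> 'm set" where
  "hom C x y = {f \<in> Ar C. Dom C f = x \<and> Cod C f = y}"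

locale category =
  fixes C :: "('o, 'm) cat"
  assumes Dom_in: "f \<in> Ar C \<Longrightarrow> Dom C f \<in> Ob C"
    and Cod_in: "f \<in> Ar C \<Longrightarrow> Cod C f \<in> Ob C"
    and Ident_hom: "x \<in> Ob C \<Longrightarrow> Ident C x \<in> hom C x x"
    and Comp_hom: "f \<in> hom C x y \<Longrightarrow> g \<in> hom C y z \<Longrightarrow> Comp C g f \<in> hom C x z"
    and Comp_Ident: "f \<in> hom C x y \<Longrightarrow> Comp C f (Ident C x) = f"
    and Ident_Comp: "f \<in> hom C x y \<Longrightarrow> Comp C (Ident C y) f = f"
    and Comp_assoc: "f \<in> hom C w x \<Longrightarrow> g \<in> hom C x y \<Longrightarrow> h \<in> hom C y z \<Longrightarrow>
      Comp C (Comp C h g) f = Comp C h (Comp C g f)"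

definition op_cat :: "('o, 'm) cat \<Rightarrow> ('o, 'm) cat" where
  "op_cat C = \<lparr>Ob = Ob C, Ar = Ar C, Dom = Cod C, Cod = Dom C, Ident = Ident C,
     Comp = (\<lambda>g f. Comp C f g)\<rparr>"

definition initial :: "('o, 'm) cat \<Rightarrow> 'o \<Rightarrow> bool" where
  "initial C x \<longleftrightarrow> x \<in> Ob C \<and> (\<forall>y \<in> Ob C. \<exists>!f. f \<in> hom C x y)"

definition terminal :: "('o, 'm) cat \<Rightarrow> 'o \<Rightarrow> bool" where
  "terminal C x \<longleftrightarrow> x \<in> Ob C \<and> (\<forall>y \<in> Ob C. \<exists>!f. f \<in> hom C y x)"

definition isomorphism :: "('o, 'm) cat \<Rightarrow> 'm \<Rightarrow> bool" where
  "isomorphism C f \<longleftrightarrow> f \<in> Ar C \<and>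
     (\<exists>g \<in> hom C (Cod C f) (Dom C f).
        Comp C g f = Ident C (Dom C f) \<and> Comp C f g = Ident C (Cod C f))"

record ('o, 'm, 'p, 'n) fnctr =
  FOb :: "'o \<Rightarrow> 'p"
  FAr :: "'m \<Rightarrow> 'n"

locale cat_functor =
  A: category A + B: category B
  for A :: "('o, 'm) cat" and B :: "('p, 'n) cat" +
  fixes F :: "('o, 'm, 'p, 'n) fnctr"
  assumes FOb_in: "x \<in> Ob A \<Longrightarrow> FOb F x \<in> Ob B"
    and FAr_hom: "f \<in> hom A x y \<Longrightarrow> FAr F f \<in> hom B (FOb F x) (FOb F y)"
    and FAr_Ident: "x \<in> Ob A \<Longrightarrow> FAr F (Ident A x) = Ident B (FOb F x)"
    and FAr_Comp: "f \<in> hom A x y \<Longrightarrow> g \<in> hom A y z \<Longrightarrow>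
      FAr F (Comp A g f) = Comp B (FAr F g) (FAr F f)"

definition id_fnctr :: "('o, 'm, 'o, 'm) fnctr" where
  "id_fnctr = \<lparr>FOb = (\<lambda>x. x), FAr = (\<lambda>f. f)\<rparr>"

definition comp_fnctr ::
  "('p, 'n, 'q, 'k) fnctr \<Rightarrow> ('o, 'm, 'p, 'n) fnctr \<Rightarrow> ('o, 'm, 'q, 'k) fnctr"
  (infixr "\<circ>\<^sub>F" 55) where
  "G \<circ>\<^sub>F F = \<lparr>FOb = (\<lambda>x. FOb G (FOb F x)), FAr = (\<lambda>f. FAr G (FAr F f))\<rparr>"

text \<open>Equality of functors out of A: the underlying HOL functions are total, so values outside
  A are disregarded.\<close>

definition fnctr_eq :: "('o, 'm) cat \<Rightarrow> ('o, 'm, 'p, 'n) fnctr \<Rightarrow> ('o, 'm, 'p, 'n) fnctr \<Rightarrow> bool"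
  where
  "fnctr_eq A F G \<longleftrightarrow> (\<forall>x \<in> Ob A. FOb F x = FOb G x) \<and> (\<forall>f \<in> Ar A. FAr F f = FAr G f)"

definition preserves_initial ::
  "('o, 'm) cat \<Rightarrow> ('p, 'n) cat \<Rightarrow> ('o, 'm, 'p, 'n) fnctr \<Rightarrow> bool" where
  "preserves_initial A B F \<longleftrightarrow> (\<forall>x. initial A x \<longrightarrow> initial B (FOb F x))"

definition natural_transformation ::
  "('o, 'm) cat \<Rightarrow> ('p, 'n) cat \<Rightarrow> ('o, 'm, 'p, 'n) fnctr \<Rightarrow> ('o, 'm, 'p, 'n) fnctr \<Rightarrow>
   ('o \<Rightarrow> 'n) \<Rightarrow> bool" where
  "natural_transformation A B F G t \<longleftrightarrow>
     cat_functor A B F \<and> cat_functor A B G \<and>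
     (\<forall>x \<in> Ob A. t x \<in> hom B (FOb F x) (FOb G x)) \<and>
     (\<forall>x y. \<forall>f \<in> hom A x y. Comp B (t y) (FAr F f) = Comp B (FAr G f) (t x))"

definition natural_isomorphism ::
  "('o, 'm) cat \<Rightarrow> ('p, 'n) cat \<Rightarrow> ('o, 'm, 'p, 'n) fnctr \<Rightarrow> ('o, 'm, 'p, 'n) fnctr \<Rightarrow>
   ('o \<Rightarrow> 'n) \<Rightarrow> bool" where
  "natural_isomorphism A B F G t \<longleftrightarrow>
     natural_transformation A B F G t \<and> (\<forall>x \<in> Ob A. isomorphism B (t x))"

definition adjunction ::
  "('o, 'm) cat \<Rightarrow> ('p, 'n) cat \<Rightarrow> ('o, 'm, 'p, 'n) fnctr \<Rightarrow> ('p, 'n, 'o, 'm) fnctr \<Rightarrow>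
   ('o \<Rightarrow> 'm) \<Rightarrow> ('p \<Rightarrow> 'n) \<Rightarrow> bool" where
  "adjunction A B L R \<eta> \<epsilon> \<longleftrightarrow>
     cat_functor A B L \<and> cat_functor B A R \<and>
     natural_transformation A A id_fnctr (R \<circ>\<^sub>F L) \<eta> \<and>
     natural_transformation B B (L \<circ>\<^sub>F R) id_fnctr \<epsilon> \<and>
     (\<forall>x \<in> Ob A. Comp B (\<epsilon> (FOb L x)) (FAr L (\<eta> x)) = Ident B (FOb L x)) \<and>
     (\<forall>y \<in> Ob B. Comp A (FAr R (\<epsilon> y)) (\<eta> (FOb R y)) = Ident A (FOb R y))"

definition has_right_adjoint ::
  "('o, 'm) cat \<Rightarrow> ('p, 'n) cat \<Rightarrow> ('o, 'm, 'p, 'n) fnctr \<Rightarrow> bool" where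
  "has_right_adjoint A B L \<longleftrightarrow> (\<exists>R \<eta> \<epsilon>. adjunction A B L R \<eta> \<epsilon>)"

definition cartesian ::
  "('p, 'n) cat \<Rightarrow> ('o, 'm) cat \<Rightarrow> ('p, 'n, 'o, 'm) fnctr \<Rightarrow> 'm \<Rightarrow> 'n \<Rightarrow> bool" where
  "cartesian E B U f g \<longleftrightarrow> g \<in> Ar E \<and> FAr U g = f \<and>
     (\<forall>Q'. \<forall>g' \<in> hom E Q' (Cod E g). \<forall>v \<in> hom B (FOb U Q') (Dom B f).
        FAr U g' = Comp B f v \<longrightarrow>
        (\<exists>!h. h \<in> hom E Q' (Dom E g) \<and> FAr U h = v \<and> Comp E g h = g'))"

definition fibration ::
  "('p, 'n) cat \<Rightarrow> ('o, 'm) cat \<Rightarrow> ('p, 'n, 'o, 'm) fnctr \<Rightarrow> bool" where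
  "fibration E B U \<longleftrightarrow> cat_functor E B U \<and>
     (\<forall>P \<in> Ob E. \<forall>f \<in> Ar B. Cod B f = FOb U P \<longrightarrow> (\<exists>g. cartesian E B U f g \<and> Cod E g = P))"

definition opfibration ::
  "('p, 'n) cat \<Rightarrow> ('o, 'm) cat \<Rightarrow> ('p, 'n, 'o, 'm) fnctr \<Rightarrow> bool" where
  "opfibration E B U \<longleftrightarrow> fibration (op_cat E) (op_cat B) U"

definition bifibration ::
  "('p, 'n) cat \<Rightarrow> ('o, 'm) cat \<Rightarrow> ('p, 'n, 'o, 'm) fnctr \<Rightarrow> bool" where
  "bifibration E B U \<longleftrightarrow> fibration E B U \<and> opfibration E B U"

definition fibre ::
  "('p, 'n) cat \<Rightarrow> ('o, 'm) cat \<Rightarrow> ('p, 'n, 'o, 'm) fnctr \<Rightarrow> 'o \<Rightarrow> ('p, 'n) cat" where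
  "fibre E B U X = \<lparr>Ob = {P \<in> Ob E. FOb U P = X}, Ar = {f \<in> Ar E. FAr U f = Ident B X},
     Dom = Dom E, Cod = Cod E, Ident = Ident E, Comp = Comp E\<rparr>"

text \<open>The reindexings of P along f are the domains of the cartesian morphisms above f with
  codomain P. The last clause says that reindexing preserves terminal objects of fibres, whichever
  cartesian morphisms are chosen to define it.\<close>

definition truth_functor ::
  "('p, 'n) cat \<Rightarrow> ('o, 'm) cat \<Rightarrow> ('p, 'n, 'o, 'm) fnctr \<Rightarrow> ('o, 'm, 'p, 'n) fnctr \<Rightarrow> bool" where
  "truth_functor E B U K \<longleftrightarrow> cat_functor B E K \<and> fnctr_eq B (U \<circ>\<^sub>F K) id_fnctr \<and>
     (\<forall>X \<in> Ob B. terminal (fibre E B U X) (FOb K X)) \<and>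
     (\<forall>f \<in> Ar B. \<forall>g. cartesian E B U f g \<and> terminal (fibre E B U (Cod B f)) (Cod E g) \<longrightarrow>
        terminal (fibre E B U (Dom B f)) (Dom E g))"

definition ccu ::
  "('p, 'n) cat \<Rightarrow> ('o, 'm) cat \<Rightarrow> ('p, 'n, 'o, 'm) fnctr \<Rightarrow> ('o, 'm, 'p, 'n) fnctr \<Rightarrow> bool" where
  "ccu E B U K \<longleftrightarrow> fibration E B U \<and> truth_functor E B U K \<and> has_right_adjoint B E K"

definition lawvere_category ::
  "('p, 'n) cat \<Rightarrow> ('o, 'm) cat \<Rightarrow> ('p, 'n, 'o, 'm) fnctr \<Rightarrow> ('o, 'm, 'p, 'n) fnctr \<Rightarrow> bool" where
  "lawvere_category E B U K \<longleftrightarrow> ccu E B U K \<and> bifibration E B U"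

text \<open>A morphism from f to g in a slice is a triple (f, h, g), so that its domain and codomain can
  be read off.\<close>

definition slice :: "('o, 'm) cat \<Rightarrow> 'o \<Rightarrow> ('m, 'm \<times> 'm \<times> 'm) cat" where
  "slice C I = \<lparr>Ob = {f \<in> Ar C. Cod C f = I},
     Ar = {(f, h, g). f \<in> Ar C \<and> Cod C f = I \<and> g \<in> Ar C \<and> Cod C g = I \<and>
             h \<in> hom C (Dom C f) (Dom C g) \<and> Comp C g h = f},
     Dom = (\<lambda>(f, h, g). f),
     Cod = (\<lambda>(f, h, g). g),
     Ident = (\<lambda>f. (f, Ident C (Dom C f), f)),
     Comp = (\<lambda>(g', k, l) (f, h, g). (f, Comp C k h, l))\<rparr>"

text \<open>For F from A to B this is the induced functor from the slice of A over J to the slice of B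
  over F J. With F = U and J = K I it is U/I, as U K I = I; with F = K and J = I it is the truth
  functor of U/I.\<close>

definition slice_fnctr ::
  "('o, 'm, 'p, 'n) fnctr \<Rightarrow> ('m, 'm \<times> 'm \<times> 'm, 'n, 'n \<times> 'n \<times> 'n) fnctr" where
  "slice_fnctr F = \<lparr>FOb = (\<lambda>f. FAr F f), FAr = (\<lambda>(f, h, g). (FAr F f, FAr F h, FAr F g))\<rparr>"

definition alg_cat ::
  "('o, 'm) cat \<Rightarrow> ('o, 'm, 'o, 'm) fnctr \<Rightarrow>
   ('o \<times> 'm, ('o \<times> 'm) \<times> 'm \<times> ('o \<times> 'm)) cat" where
  "alg_cat C G = \<lparr>Ob = {(X, \<alpha>). X \<in> Ob C \<and> \<alpha> \<in> hom C (FOb G X) X},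
     Ar = {((X, \<alpha>), h, (Y, \<beta>)). X \<in> Ob C \<and> \<alpha> \<in> hom C (FOb G X) X \<and>
             Y \<in> Ob C \<and> \<beta> \<in> hom C (FOb G Y) Y \<and>
             h \<in> hom C X Y \<and> Comp C h \<alpha> = Comp C \<beta> (FAr G h)},
     Dom = (\<lambda>(a, h, b). a),
     Cod = (\<lambda>(a, h, b). b),
     Ident = (\<lambda>a. (a, Ident C (fst a), a)),
     Comp = (\<lambda>(b', k, c) (a, h, b). (a, Comp C k h, c))\<rparr>"

text \<open>The data of a truth-preserving lifting includes the isomorphism, with components
  \<open>\<psi> X\<close> from Ghat K X to K G X.\<close>

definition truth_preserving_lifting ::
  "('p, 'n) cat \<Rightarrow> ('o, 'm) cat \<Rightarrow> ('p, 'n, 'o, 'm) fnctr \<Rightarrow> ('o, 'm, 'p, 'n) fnctr \<Rightarrow>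
   ('o, 'm, 'o, 'm) fnctr \<Rightarrow> ('p, 'n, 'p, 'n) fnctr \<Rightarrow> ('o \<Rightarrow> 'n) \<Rightarrow> bool" where
  "truth_preserving_lifting D C V K G Ghat \<psi> \<longleftrightarrow>
     cat_functor D D Ghat \<and> fnctr_eq D (V \<circ>\<^sub>F Ghat) (G \<circ>\<^sub>F V) \<and>
     natural_isomorphism C D (Ghat \<circ>\<^sub>F K) (K \<circ>\<^sub>F G) \<psi>"

definition alg_truth_fnctr ::
  "('p, 'n) cat \<Rightarrow> ('o, 'm, 'p, 'n) fnctr \<Rightarrow> ('o \<Rightarrow> 'n) \<Rightarrow>
   ('o \<times> 'm, ('o \<times> 'm) \<times> 'm \<times> ('o \<times> 'm), 'p \<times> 'n, ('p \<times> 'n) \<times> 'n \<times> ('p \<times> 'n)) fnctr" where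
  "alg_truth_fnctr D K \<psi> =
     (let on_ob = (\<lambda>(X, \<alpha>). (FOb K X, Comp D (FAr K \<alpha>) (\<psi> X)))
      in \<lparr>FOb = on_ob, FAr = (\<lambda>(a, h, b). (on_ob a, FAr K h, on_ob b))\<rparr>)"

definition sound_induction_rule ::
  "('p, 'n) cat \<Rightarrow> ('o, 'm) cat \<Rightarrow> ('o, 'm, 'p, 'n) fnctr \<Rightarrow>
   ('o, 'm, 'o, 'm) fnctr \<Rightarrow> ('p, 'n, 'p, 'n) fnctr \<Rightarrow> ('o \<Rightarrow> 'n) \<Rightarrow> bool" where
  "sound_induction_rule D C K G Ghat \<psi> \<longleftrightarrow>
     preserves_initial (alg_cat C G) (alg_cat D Ghat) (alg_truth_fnctr D K \<psi>)"

end

theory Submission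
  imports Defs
begin

text \<open>Write \<open>T\<close> for the truth functor, \<open>R\<close> for comprehension with counit \<open>e\<close>, and
  \<open>\<pi> P = V (e P) : R P \<rightarrow> V P\<close>. A functor \<open>G\<close> on the base is lifted to
  \<open>P \<mapsto> Q P\<close>, the codomain of an opcartesian morphism \<open>lam P\<close> above \<open>G (\<pi> P)\<close> with domain
  \<open>T (G (R P))\<close>. Morphisms into \<open>T X\<close> correspond to their images in the base, so \<open>T\<close> is full and
  faithful, \<open>\<pi> (T X)\<close> is invertible, and the lifting preserves truth. Soundness holds for every
  truth-preserving lifting, by transposition along the adjunction of \<open>T\<close> and \<open>R\<close>. The argument
  needs only unique lifts into truth objects, opcartesian lifts and universal arrows from \<open>T\<close>, and
  all three pass from \<open>U\<close> to \<open>U/I\<close>: the comprehension of \<open>p : P \<rightarrow> K I\<close> is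
  \<open>U p \<circ> \<pi> P : R P \<rightarrow> I\<close>, and a triangle over \<open>K I\<close> commutes as soon as its image over \<open>I\<close> does.\<close>

section \<open>Hom-sets, composite functors and morphisms encoded as triples\<close>

lemma homI: "f \<in> Ar C \<Longrightarrow> Dom C f = x \<Longrightarrow> Cod C f = y \<Longrightarrow> f \<in> hom C x y"
  by (simp add: hom_def)

lemma homD: "f \<in> hom C x y \<Longrightarrow> f \<in> Ar C \<and> Dom C f = x \<and> Cod C f = y"
  by (simp add: hom_def)

lemma (in category) hom_Ob: "f \<in> hom C x y \<Longrightarrow> x \<in> Ob C \<and> y \<in> Ob C"
  using Dom_in Cod_in by (auto simp: hom_def)

lemma cat_functor_comp:
  assumes "cat_functor A B F" "cat_functor B C G"
  shows "cat_functor A C (G \<circ>\<^sub>F F)"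
proof -
  interpret F: cat_functor A B F by fact
  interpret G: cat_functor B C G by fact
  show ?thesis
    by unfold_locales
      (auto simp: comp_fnctr_def F.FOb_in G.FOb_in F.FAr_Ident G.FAr_Ident F.FAr_Comp
        G.FAr_Comp[OF F.FAr_hom F.FAr_hom] intro: F.FAr_hom G.FAr_hom)
qed

text \<open>Morphisms of slices and of algebra categories are triples carrying their domain and
  codomain. Once these ends are fixed, unique existence only concerns the middle component.\<close>

lemma ex1_triple: "(\<exists>!t. \<exists>h. t = (a, h, b) \<and> P h) \<longleftrightarrow> (\<exists>!h. P h)"
proof
  assume "\<exists>!t. \<exists>h. t = (a, h, b) \<and> P h"
  then obtain h where h: "P h" and uniq: "\<And>t. \<exists>h. t = (a, h, b) \<and> P h \<Longrightarrow> t = (a, h, b)"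
    by blast
  show "\<exists>!h. P h" by (rule ex1I[of _ h]) (use h uniq in auto)
qed blast

lemma hom_alg_cat:
  assumes "X \<in> Ob C" "\<alpha> \<in> hom C (FOb G X) X" "Y \<in> Ob C" "\<beta> \<in> hom C (FOb G Y) Y"
  shows "f \<in> hom (alg_cat C G) (X, \<alpha>) (Y, \<beta>) \<longleftrightarrow>
    (\<exists>h. f = ((X, \<alpha>), h, (Y, \<beta>)) \<and> h \<in> hom C X Y \<and> Comp C h \<alpha> = Comp C \<beta> (FAr G h))"
  using assms unfolding hom_def[of "alg_cat C G"] by (auto simp: alg_cat_def)

section \<open>Comprehension and soundness\<close>

text \<open>Comprehension enters as a family of universal arrows \<open>e P\<close> from
  \<open>T\<close> rather than as a functor: this form passes directly to slices, and
  \<open>Rmap\<close> recovers the action on morphisms.\<close>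

locale truth_comprehension =
  V: cat_functor D C V + T: cat_functor C D T
  for D :: "('p, 'n) cat" and C :: "('o, 'm) cat"
    and V :: "('p, 'n, 'o, 'm) fnctr" and T :: "('o, 'm, 'p, 'n) fnctr" +
  fixes R :: "'p \<Rightarrow> 'o" and e :: "'p \<Rightarrow> 'n"
  assumes VT_Ob: "X \<in> Ob C \<Longrightarrow> FOb V (FOb T X) = X"
    and VT_Ar: "f \<in> Ar C \<Longrightarrow> FAr V (FAr T f) = f"
    and truth_lift: "P \<in> Ob D \<Longrightarrow> f \<in> hom C (FOb V P) X \<Longrightarrow>
      \<exists>!g. g \<in> hom D P (FOb T X) \<and> FAr V g = f"
    and e_hom: "P \<in> Ob D \<Longrightarrow> e P \<in> hom D (FOb T (R P)) P"
    and R_Ob: "P \<in> Ob D \<Longrightarrow> R P \<in> Ob C"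
    and e_universal: "P \<in> Ob D \<Longrightarrow> X \<in> Ob C \<Longrightarrow> h \<in> hom D (FOb T X) P \<Longrightarrow>
      \<exists>!k. k \<in> hom C X (R P) \<and> Comp D (e P) (FAr T k) = h"
begin

text \<open>The uniqueness half of \<open>truth_lift\<close>, in the form in which equations in
  \<open>D\<close> are later settled by computing in the base.\<close>

lemma truth_unique:
  assumes "X \<in> Ob C" "g \<in> hom D P (FOb T X)" "g' \<in> hom D P (FOb T X)" "FAr V g = FAr V g'"
  shows "g = g'"
proof -
  have "P \<in> Ob D" using assms(2) V.A.hom_Ob by blast
  moreover have "FAr V g' \<in> hom C (FOb V P) X"
    using V.FAr_hom[OF assms(3)] VT_Ob[OF assms(1)] by simp
  ultimately show ?thesis using truth_lift assms by blast
qed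

lemma e_unique:
  assumes "P \<in> Ob D" "k \<in> hom C X (R P)" "k' \<in> hom C X (R P)"
    "Comp D (e P) (FAr T k) = Comp D (e P) (FAr T k')"
  shows "k = k'"
proof -
  have X: "X \<in> Ob C" using assms(2) V.B.hom_Ob by blast
  have "Comp D (e P) (FAr T k') \<in> hom D (FOb T X) P"
    using V.A.Comp_hom[OF T.FAr_hom[OF assms(3)] e_hom[OF assms(1)]] .
  then show ?thesis using e_universal[OF assms(1) X] assms by blast
qed

section \<open>Transposition, functoriality of comprehension, projection and unit\<close>

definition transp :: "'p \<Rightarrow> 'o \<Rightarrow> 'n \<Rightarrow> 'm" where
  "transp P X f = (THE k. k \<in> hom C X (R P) \<and> Comp D (e P) (FAr T k) = f)"

lemma transp:
  assumes "P \<in> Ob D" "X \<in> Ob C" "f \<in> hom D (FOb T X) P"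
  shows transp_hom: "transp P X f \<in> hom C X (R P)"
    and e_transp: "Comp D (e P) (FAr T (transp P X f)) = f"
  using theI'[OF e_universal[OF assms]] unfolding transp_def by auto

definition Rmap :: "'n \<Rightarrow> 'm" where
  "Rmap h = transp (Cod D h) (R (Dom D h)) (Comp D h (e (Dom D h)))"

lemma Rmap:
  assumes "h \<in> hom D P Q"
  shows Rmap_hom: "Rmap h \<in> hom C (R P) (R Q)"
    and e_Rmap: "Comp D (e Q) (FAr T (Rmap h)) = Comp D h (e P)"
proof -
  have P: "P \<in> Ob D" and Q: "Q \<in> Ob D" using assms V.A.hom_Ob by auto
  have "Comp D h (e P) \<in> hom D (FOb T (R P)) Q"
    using V.A.Comp_hom[OF e_hom[OF P] assms] .
  from transp[OF Q R_Ob[OF P] this]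
  show "Rmap h \<in> hom C (R P) (R Q)" "Comp D (e Q) (FAr T (Rmap h)) = Comp D h (e P)"
    using homD[OF assms] by (simp_all add: Rmap_def)
qed

lemma Rmap_Ident:
  assumes "P \<in> Ob D"
  shows "Rmap (Ident D P) = Ident C (R P)"
proof -
  have "Comp D (e P) (FAr T (Rmap (Ident D P))) = Comp D (Ident D P) (e P)"
    using e_Rmap[OF V.A.Ident_hom[OF assms]] .
  also have "\<dots> = Comp D (e P) (FAr T (Ident C (R P)))"
    using V.A.Ident_Comp[OF e_hom[OF assms]] V.A.Comp_Ident[OF e_hom[OF assms]]
      T.FAr_Ident[OF R_Ob[OF assms]] by simp
  finally show ?thesis
    using e_unique[OF assms Rmap_hom[OF V.A.Ident_hom[OF assms]] V.B.Ident_hom[OF R_Ob[OF assms]]]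
    by blast
qed

lemma Rmap_Comp:
  assumes h: "h \<in> hom D P Q" and k: "k \<in> hom D Q S"
  shows "Rmap (Comp D k h) = Comp C (Rmap k) (Rmap h)"
proof -
  have P: "P \<in> Ob D" and Q: "Q \<in> Ob D" and S: "S \<in> Ob D" using h k V.A.hom_Ob by auto
  note rh = Rmap_hom[OF h] and rk = Rmap_hom[OF k]
  have kh: "Comp D k h \<in> hom D P S" using V.A.Comp_hom[OF h k] .
  have "Comp D (e S) (FAr T (Comp C (Rmap k) (Rmap h)))
      = Comp D (Comp D (e S) (FAr T (Rmap k))) (FAr T (Rmap h))"
    using T.FAr_Comp[OF rh rk] V.A.Comp_assoc[OF T.FAr_hom[OF rh] T.FAr_hom[OF rk] e_hom[OF S]]
    by simp
  also have "\<dots> = Comp D k (Comp D (e Q) (FAr T (Rmap h)))"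
    using e_Rmap[OF k] V.A.Comp_assoc[OF T.FAr_hom[OF rh] e_hom[OF Q] k] by simp
  also have "\<dots> = Comp D (Comp D k h) (e P)"
    using e_Rmap[OF h] V.A.Comp_assoc[OF e_hom[OF P] h k] by simp
  also have "\<dots> = Comp D (e S) (FAr T (Rmap (Comp D k h)))"
    using e_Rmap[OF kh] by simp
  finally show ?thesis
    using e_unique[OF S Rmap_hom[OF kh] V.B.Comp_hom[OF rh rk]] by simp
qed

definition proj :: "'p \<Rightarrow> 'm" where
  "proj P = FAr V (e P)"

lemma proj_hom: "P \<in> Ob D \<Longrightarrow> proj P \<in> hom C (R P) (FOb V P)"
  using V.FAr_hom[OF e_hom] VT_Ob[OF R_Ob] by (simp add: proj_def)

text \<open>The image under \<open>V\<close> of \<open>e_Rmap\<close>, the naturality square of the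
  counit.\<close>

lemma proj_natural:
  assumes "h \<in> hom D P Q"
  shows "Comp C (proj Q) (Rmap h) = Comp C (FAr V h) (proj P)"
proof -
  have P: "P \<in> Ob D" and Q: "Q \<in> Ob D" using assms V.A.hom_Ob by auto
  have "FAr V (Comp D (e Q) (FAr T (Rmap h))) = FAr V (Comp D h (e P))"
    using e_Rmap[OF assms] by simp
  then show ?thesis
    using V.FAr_Comp[OF T.FAr_hom[OF Rmap_hom[OF assms]] e_hom[OF Q]]
      V.FAr_Comp[OF e_hom[OF P] assms] VT_Ar homD[OF Rmap_hom[OF assms]]
    by (simp add: proj_def)
qed

definition unit :: "'o \<Rightarrow> 'm" where
  "unit X = transp (FOb T X) X (Ident D (FOb T X))"

text \<open>Applying \<open>V\<close> to \<open>e_unit\<close> makes the unit a section of the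
  projection. The other composite is compared with the identity by \<open>e_unique\<close>, once
  \<open>T\<close> of the projection is identified with the counit.\<close>

lemma unit:
  assumes "X \<in> Ob C"
  shows unit_hom: "unit X \<in> hom C X (R (FOb T X))"
    and e_unit: "Comp D (e (FOb T X)) (FAr T (unit X)) = Ident D (FOb T X)"
    and proj_unit: "Comp C (proj (FOb T X)) (unit X) = Ident C X"
    and unit_proj: "Comp C (unit X) (proj (FOb T X)) = Ident C (R (FOb T X))"
proof -
  let ?P = "FOb T X"
  have P: "?P \<in> Ob D" using T.FOb_in[OF assms] .
  show uh: "unit X \<in> hom C X (R ?P)" and eu: "Comp D (e ?P) (FAr T (unit X)) = Ident D ?P"
    using transp[OF P assms V.A.Ident_hom[OF P]] by (simp_all add: unit_def)
  have "FAr V (Comp D (e ?P) (FAr T (unit X))) = Comp C (proj ?P) (unit X)"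
    using V.FAr_Comp[OF T.FAr_hom[OF uh] e_hom[OF P]] VT_Ar homD[OF uh] by (simp add: proj_def)
  then show "Comp C (proj ?P) (unit X) = Ident C X"
    using eu V.FAr_Ident[OF P] VT_Ob[OF assms] by simp
  have ph: "proj ?P \<in> hom C (R ?P) X" using proj_hom[OF P] VT_Ob[OF assms] by simp
  \<comment> \<open>Both sides end in the truth object \<open>T X\<close> and have image
    \<open>proj ?P\<close> in the base.\<close>
  have "FAr T (proj ?P) = e ?P"
    by (rule truth_unique[OF assms T.FAr_hom[OF ph] e_hom[OF P]])
      (use VT_Ar homD[OF ph] in \<open>simp add: proj_def\<close>)
  then have "Comp D (e ?P) (FAr T (Comp C (unit X) (proj ?P))) = e ?P"
    using T.FAr_Comp[OF ph uh] V.A.Comp_assoc[OF T.FAr_hom[OF ph] T.FAr_hom[OF uh] e_hom[OF P]]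
      eu V.A.Ident_Comp[OF e_hom[OF P]] by simp
  also have "\<dots> = Comp D (e ?P) (FAr T (Ident C (R ?P)))"
    using V.A.Comp_Ident[OF e_hom[OF P]] T.FAr_Ident[OF R_Ob[OF P]] by simp
  finally show "Comp C (unit X) (proj ?P) = Ident C (R ?P)"
    using e_unique[OF P V.B.Comp_hom[OF ph uh] V.B.Ident_hom[OF R_Ob[OF P]]] by simp
qed

text \<open>Transposing along the universal arrows turns algebra structures on \<open>P\<close> into algebra
  structures on \<open>R P\<close>, so the truth functor on algebras is a left adjoint.\<close>

lemma lifting_sound:
  assumes G: "cat_functor C C G"
    and lift: "truth_preserving_lifting D C V T G H \<psi>"
  shows "sound_induction_rule D C T G H \<psi>"
proof -
  interpret G: cat_functor C C G by (rule G)
  interpret H: cat_functor D D H using lift by (simp add: truth_preserving_lifting_def)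
  have nat: "natural_isomorphism C D (H \<circ>\<^sub>F T) (T \<circ>\<^sub>F G) \<psi>"
    using lift by (simp add: truth_preserving_lifting_def)
  have psi_hom: "\<psi> X \<in> hom D (FOb H (FOb T X)) (FOb T (FOb G X))" if "X \<in> Ob C" for X
    using nat that
    by (simp add: natural_isomorphism_def natural_transformation_def comp_fnctr_def)
  have psi_nat: "Comp D (\<psi> Y) (FAr H (FAr T f)) = Comp D (FAr T (FAr G f)) (\<psi> X)"
    if "f \<in> hom C X Y" for f X Y
    using nat that
    by (simp add: natural_isomorphism_def natural_transformation_def comp_fnctr_def)
  have psi_iso: "\<exists>g \<in> hom D (FOb T (FOb G X)) (FOb H (FOb T X)).
      Comp D g (\<psi> X) = Ident D (FOb H (FOb T X)) \<and>
      Comp D (\<psi> X) g = Ident D (FOb T (FOb G X))" if "X \<in> Ob C" for X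
  proof -
    have "isomorphism D (\<psi> X)" using nat that by (simp add: natural_isomorphism_def)
    then show ?thesis using homD[OF psi_hom[OF that]] by (simp add: isomorphism_def)
  qed
  have "initial (alg_cat D H) (FOb T X, Comp D (FAr T \<alpha>) (\<psi> X))"
    if ini: "initial (alg_cat C G) (X, \<alpha>)" for X \<alpha>
  proof -
    have X: "X \<in> Ob C" and \<alpha>: "\<alpha> \<in> hom C (FOb G X) X"
      using ini by (auto simp: initial_def alg_cat_def)
    note TX = T.FOb_in[OF X] and GX = G.FOb_in[OF X]
    note psiX = psi_hom[OF X] and T\<alpha> = T.FAr_hom[OF \<alpha>]
    define a where "a = Comp D (FAr T \<alpha>) (\<psi> X)"
    have a: "a \<in> hom D (FOb H (FOb T X)) (FOb T X)"
      unfolding a_def using V.A.Comp_hom[OF psiX T\<alpha>] .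
    have weak: "\<exists>!k. k \<in> hom C X Y \<and> Comp C k \<alpha> = Comp C \<gamma> (FAr G k)"
      if Y: "Y \<in> Ob C" and \<gamma>: "\<gamma> \<in> hom C (FOb G Y) Y" for Y \<gamma>
    proof -
      have "(Y, \<gamma>) \<in> Ob (alg_cat C G)" using that by (simp add: alg_cat_def)
      then have "\<exists>!f. f \<in> hom (alg_cat C G) (X, \<alpha>) (Y, \<gamma>)"
        using ini by (auto simp: initial_def)
      moreover have "f \<in> hom (alg_cat C G) (X, \<alpha>) (Y, \<gamma>) \<longleftrightarrow>
          (\<exists>k. f = ((X, \<alpha>), k, (Y, \<gamma>)) \<and> k \<in> hom C X Y \<and> Comp C k \<alpha> = Comp C \<gamma> (FAr G k))" for f
        using hom_alg_cat[OF X \<alpha> Y \<gamma>] .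
      ultimately show ?thesis by (simp only: ex1_triple)
    qed
    have main: "\<exists>!h. h \<in> hom D (FOb T X) P \<and> Comp D h a = Comp D \<beta> (FAr H h)"
      if P: "P \<in> Ob D" and \<beta>: "\<beta> \<in> hom D (FOb H P) P" for P \<beta>
    proof -
      note RP = R_Ob[OF P] and eP = e_hom[OF P]
      obtain i where i: "i \<in> hom D (FOb T (FOb G (R P))) (FOb H (FOb T (R P)))"
        and i\<psi>: "Comp D i (\<psi> (R P)) = Ident D (FOb H (FOb T (R P)))"
        and \<psi>i: "Comp D (\<psi> (R P)) i = Ident D (FOb T (FOb G (R P)))"
        using psi_iso[OF RP] by blast
      note HeP = H.FAr_hom[OF eP]
      define b where "b = Comp D \<beta> (FAr H (e P))"
      have b: "b \<in> hom D (FOb H (FOb T (R P))) P"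
        unfolding b_def using V.A.Comp_hom[OF HeP \<beta>] .
      \<comment> \<open>The structure on \<open>R P\<close> is the transpose of the composite T(G(R
        P)) -> H(T(R P)) -> H P -> P of \<open>i\<close>, \<open>H (e P)\<close> and
        \<open>\<beta>\<close>, where \<open>i\<close> inverts \<open>\<psi> (R P)\<close>.\<close>
      define \<gamma> where "\<gamma> = transp P (FOb G (R P)) (Comp D b i)"
      have \<gamma>: "\<gamma> \<in> hom C (FOb G (R P)) (R P)"
        and e\<gamma>: "Comp D (e P) (FAr T \<gamma>) = Comp D b i"
        unfolding \<gamma>_def using transp[OF P G.FOb_in[OF RP] V.A.Comp_hom[OF i b]] by auto
      have e\<gamma>\<psi>: "Comp D (Comp D (e P) (FAr T \<gamma>)) (\<psi> (R P)) = b"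
        using e\<gamma> V.A.Comp_assoc[OF psi_hom[OF RP] i b] i\<psi> V.A.Comp_Ident[OF b] by simp
      \<comment> \<open>Under transposition, \<open>H\<close>-algebra morphisms from
        \<open>(T X, a)\<close> to \<open>(P, \<beta>)\<close> correspond to
        \<open>G\<close>-algebra morphisms from \<open>(X, \<alpha>)\<close> to
        \<open>(R P, \<gamma>)\<close>. Each side of the first equation is rewritten as
        \<open>e P\<close> after \<open>T\<close> of the corresponding side of the second,
        precomposed with \<open>\<psi> X\<close>. It remains to cancel \<open>\<psi> X\<close> and
        to apply \<open>e_unique\<close>.\<close>
      have key: "Comp D (Comp D (e P) (FAr T k)) a = Comp D \<beta> (FAr H (Comp D (e P) (FAr T k)))
          \<longleftrightarrow> Comp C k \<alpha> = Comp C \<gamma> (FAr G k)" if k: "k \<in> hom C X (R P)" for k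
      proof -
        note Tk = T.FAr_hom[OF k] and Gk = G.FAr_hom[OF k]
        note TGk = T.FAr_hom[OF Gk] and HTk = H.FAr_hom[OF Tk] and T\<gamma> = T.FAr_hom[OF \<gamma>]
        note k\<alpha> = V.B.Comp_hom[OF \<alpha> k] and \<gamma>k = V.B.Comp_hom[OF Gk \<gamma>]
        have 1: "Comp D (Comp D (e P) (FAr T k)) a
            = Comp D (Comp D (e P) (FAr T (Comp C k \<alpha>))) (\<psi> X)"
        proof -
          have "Comp D (Comp D (e P) (FAr T k)) a
              = Comp D (Comp D (Comp D (e P) (FAr T k)) (FAr T \<alpha>)) (\<psi> X)"
            unfolding a_def
            using V.A.Comp_assoc[OF psiX T\<alpha> V.A.Comp_hom[OF Tk eP]] by simp
          then show ?thesis
            using V.A.Comp_assoc[OF T\<alpha> Tk eP] T.FAr_Comp[OF \<alpha> k] by simp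
        qed
        have 2: "Comp D \<beta> (FAr H (Comp D (e P) (FAr T k)))
            = Comp D (Comp D (e P) (FAr T (Comp C \<gamma> (FAr G k)))) (\<psi> X)"
        proof -
          let ?u = "Comp D (e P) (FAr T \<gamma>)"
          have u: "?u \<in> hom D (FOb T (FOb G (R P))) P" using V.A.Comp_hom[OF T\<gamma> eP] .
          have "Comp D \<beta> (FAr H (Comp D (e P) (FAr T k))) = Comp D b (FAr H (FAr T k))"
            unfolding b_def using H.FAr_Comp[OF Tk eP] V.A.Comp_assoc[OF HTk HeP \<beta>] by simp
          also have "\<dots> = Comp D ?u (Comp D (\<psi> (R P)) (FAr H (FAr T k)))"
            using e\<gamma>\<psi> V.A.Comp_assoc[OF HTk psi_hom[OF RP] u] by simp
          also have "\<dots> = Comp D (Comp D ?u (FAr T (FAr G k))) (\<psi> X)"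
            using psi_nat[OF k] V.A.Comp_assoc[OF psiX TGk u] by simp
          also have "\<dots> = Comp D (Comp D (e P) (FAr T (Comp C \<gamma> (FAr G k)))) (\<psi> X)"
            using V.A.Comp_assoc[OF TGk T\<gamma> eP] T.FAr_Comp[OF Gk \<gamma>] by simp
          finally show ?thesis .
        qed
        \<comment> \<open>The right inverse \<open>j\<close> of \<open>\<psi> X\<close> makes it an
          epimorphism.\<close>
        have cancel: "f = g"
          if f: "f \<in> hom D (FOb T (FOb G X)) P" and g: "g \<in> hom D (FOb T (FOb G X)) P"
            and eq: "Comp D f (\<psi> X) = Comp D g (\<psi> X)" for f g
        proof -
          obtain j where j: "j \<in> hom D (FOb T (FOb G X)) (FOb H (FOb T X))"
            and \<psi>j: "Comp D (\<psi> X) j = Ident D (FOb T (FOb G X))"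
            using psi_iso[OF X] by blast
          have "Comp D f (Comp D (\<psi> X) j) = Comp D g (Comp D (\<psi> X) j)"
            using eq V.A.Comp_assoc[OF j psiX f] V.A.Comp_assoc[OF j psiX g] by simp
          then show ?thesis using \<psi>j V.A.Comp_Ident[OF f] V.A.Comp_Ident[OF g] by simp
        qed
        show ?thesis
          unfolding 1 2
          using cancel[OF V.A.Comp_hom[OF T.FAr_hom[OF k\<alpha>] eP]
              V.A.Comp_hom[OF T.FAr_hom[OF \<gamma>k] eP]] e_unique[OF P k\<alpha> \<gamma>k]
          by metis
      qed
      from weak[OF RP \<gamma>] obtain k where k: "k \<in> hom C X (R P)"
        and k_alg: "Comp C k \<alpha> = Comp C \<gamma> (FAr G k)"
        and k_unique: "\<And>k'. k' \<in> hom C X (R P) \<Longrightarrow> Comp C k' \<alpha> = Comp C \<gamma> (FAr G k') \<Longrightarrow> k' = k"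
        by blast
      show ?thesis
      proof (intro ex1I conjI)
        show "Comp D (e P) (FAr T k) \<in> hom D (FOb T X) P"
          using V.A.Comp_hom[OF T.FAr_hom[OF k] eP] .
        show "Comp D (Comp D (e P) (FAr T k)) a = Comp D \<beta> (FAr H (Comp D (e P) (FAr T k)))"
          using key[OF k] k_alg by simp
        fix h assume "h \<in> hom D (FOb T X) P \<and> Comp D h a = Comp D \<beta> (FAr H h)"
        then have hh: "h \<in> hom D (FOb T X) P" and h_alg: "Comp D h a = Comp D \<beta> (FAr H h)" by auto
        note tr = transp[OF P X hh]
        \<comment> \<open>\<open>h\<close> is \<open>e P\<close> after \<open>T\<close> of its
          transpose, and \<open>key\<close> makes that transpose an algebra morphism, so initiality
          of \<open>(X, \<alpha>)\<close> identifies it with \<open>k\<close>.\<close>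
        have "transp P X h = k"
          using k_unique[OF tr(1)] key[OF tr(1)] h_alg unfolding tr(2) by blast
        then show "h = Comp D (e P) (FAr T k)" using tr(2) by simp
      qed
    qed
    show ?thesis
      unfolding initial_def a_def[symmetric]
    proof (intro conjI ballI)
      show "(FOb T X, a) \<in> Ob (alg_cat D H)" using TX a by (simp add: alg_cat_def)
      fix y assume "y \<in> Ob (alg_cat D H)"
      then obtain P \<beta> where y: "y = (P, \<beta>)" and P: "P \<in> Ob D" and \<beta>: "\<beta> \<in> hom D (FOb H P) P"
        by (auto simp: alg_cat_def)
      have "f \<in> hom (alg_cat D H) (FOb T X, a) y \<longleftrightarrow>
          (\<exists>h. f = ((FOb T X, a), h, y) \<and> h \<in> hom D (FOb T X) P \<and>
            Comp D h a = Comp D \<beta> (FAr H h))" for f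
        unfolding y using hom_alg_cat[OF TX a P \<beta>] .
      then show "\<exists>!f. f \<in> hom (alg_cat D H) (FOb T X, a) y"
        using main[OF P \<beta>] by (simp only: ex1_triple)
    qed
  qed
  then show ?thesis
    by (auto simp: sound_induction_rule_def preserves_initial_def alg_truth_fnctr_def Let_def)
qed

end

section \<open>The opcartesian lifting\<close>

text \<open>\<open>lam P\<close> is opcartesian above \<open>G\<close> of the projection of
  \<open>P\<close>. The universal property takes \<open>v\<close> out of \<open>G (V P)\<close>, as
  \<open>V (Q P) = G (V P)\<close> is derived only afterwards, in \<open>V_Q\<close>.\<close>

locale truth_lifting =
  truth_comprehension D C V T R e + G: cat_functor C C G
  for D :: "('p, 'n) cat" and C :: "('o, 'm) cat"
    and V :: "('p, 'n, 'o, 'm) fnctr" and T :: "('o, 'm, 'p, 'n) fnctr"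
    and R :: "'p \<Rightarrow> 'o" and e :: "'p \<Rightarrow> 'n" and G :: "('o, 'm, 'o, 'm) fnctr" +
  fixes Q :: "'p \<Rightarrow> 'p" and lam :: "'p \<Rightarrow> 'n"
  assumes lam_hom: "P \<in> Ob D \<Longrightarrow> lam P \<in> hom D (FOb T (FOb G (R P))) (Q P)"
    and V_lam: "P \<in> Ob D \<Longrightarrow> FAr V (lam P) = FAr G (FAr V (e P))"
    and lam_universal: "P \<in> Ob D \<Longrightarrow> k \<in> hom D (FOb T (FOb G (R P))) P' \<Longrightarrow>
      v \<in> hom C (FOb G (FOb V P)) (FOb V P') \<Longrightarrow>
      FAr V k = Comp C v (FAr G (FAr V (e P))) \<Longrightarrow>
      \<exists>!h. h \<in> hom D (Q P) P' \<and> FAr V h = v \<and> Comp D h (lam P) = k"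
begin

lemma Q_Ob: "P \<in> Ob D \<Longrightarrow> Q P \<in> Ob D"
  using lam_hom V.A.hom_Ob by blast

lemma G_proj_hom: "P \<in> Ob D \<Longrightarrow> FAr G (proj P) \<in> hom C (FOb G (R P)) (FOb G (FOb V P))"
  using G.FAr_hom[OF proj_hom] .

lemma V_Q: "P \<in> Ob D \<Longrightarrow> FOb V (Q P) = FOb G (FOb V P)"
  using V.FAr_hom[OF lam_hom] V_lam G_proj_hom by (fastforce simp: hom_def proj_def)

text \<open>The uniqueness half of \<open>lam_universal\<close>; it yields the functor laws of the
  lifting and one of the two identities that make \<open>psi X\<close> invertible.\<close>

lemma lam_unique:
  assumes P: "P \<in> Ob D" and h: "h \<in> hom D (Q P) P'" and h': "h' \<in> hom D (Q P) P'"
    and "FAr V h = FAr V h'" "Comp D h (lam P) = Comp D h' (lam P)"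
  shows "h = h'"
proof -
  have v: "FAr V h' \<in> hom C (FOb G (FOb V P)) (FOb V P')" using V.FAr_hom[OF h'] V_Q[OF P] by simp
  have "FAr V (Comp D h' (lam P)) = Comp C (FAr V h') (FAr G (FAr V (e P)))"
    using V.FAr_Comp[OF lam_hom[OF P] h'] V_lam[OF P] by simp
  from lam_universal[OF P V.A.Comp_hom[OF lam_hom[OF P] h'] v this] show ?thesis
    using assms by blast
qed

section \<open>The lifting on morphisms and its functoriality\<close>

definition Qmap :: "'n \<Rightarrow> 'n" where
  "Qmap h = (THE k. k \<in> hom D (Q (Dom D h)) (Q (Cod D h)) \<and> FAr V k = FAr G (FAr V h) \<and>
     Comp D k (lam (Dom D h)) = Comp D (lam (Cod D h)) (FAr T (FAr G (Rmap h))))"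

text \<open>The factorization through \<open>lam P\<close> exists because
  \<open>proj_natural\<close>, carried along \<open>G\<close>, shows that \<open>lam P'\<close>
  after \<open>T (G (Rmap h))\<close> lies above \<open>G (V h)\<close> after
  \<open>G (proj P)\<close>.\<close>

lemma Qmap:
  assumes h: "h \<in> hom D P P'"
  shows Qmap_hom: "Qmap h \<in> hom D (Q P) (Q P')"
    and V_Qmap: "FAr V (Qmap h) = FAr G (FAr V h)"
    and Qmap_lam: "Comp D (Qmap h) (lam P) = Comp D (lam P') (FAr T (FAr G (Rmap h)))"
proof -
  have P: "P \<in> Ob D" and P': "P' \<in> Ob D" using h V.A.hom_Ob by auto
  note Gr = G.FAr_hom[OF Rmap_hom[OF h]]
  note TGr = T.FAr_hom[OF Gr]
  have "FAr V (Comp D (lam P') (FAr T (FAr G (Rmap h)))) = FAr G (Comp C (proj P') (Rmap h))"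
    using V.FAr_Comp[OF TGr lam_hom[OF P']] V_lam[OF P'] VT_Ar homD[OF Gr]
      G.FAr_Comp[OF Rmap_hom[OF h] proj_hom[OF P']] by (simp add: proj_def)
  also have "\<dots> = Comp C (FAr G (FAr V h)) (FAr G (FAr V (e P)))"
    using proj_natural[OF h] G.FAr_Comp[OF proj_hom[OF P] V.FAr_hom[OF h]] by (simp add: proj_def)
  finally have eq: "FAr V (Comp D (lam P') (FAr T (FAr G (Rmap h))))
      = Comp C (FAr G (FAr V h)) (FAr G (FAr V (e P)))" .
  have v: "FAr G (FAr V h) \<in> hom C (FOb G (FOb V P)) (FOb V (Q P'))"
    using G.FAr_hom[OF V.FAr_hom[OF h]] V_Q[OF P'] by simp
  from theI'[OF lam_universal[OF P V.A.Comp_hom[OF TGr lam_hom[OF P']] v eq]]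
  show "Qmap h \<in> hom D (Q P) (Q P')" "FAr V (Qmap h) = FAr G (FAr V h)"
    "Comp D (Qmap h) (lam P) = Comp D (lam P') (FAr T (FAr G (Rmap h)))"
    using homD[OF h] by (simp_all add: Qmap_def)
qed

definition H :: "('p, 'n, 'p, 'n) fnctr" where
  "H = \<lparr>FOb = Q, FAr = Qmap\<rparr>"

text \<open>Both laws follow from \<open>lam_unique\<close>: in the base from functoriality of
  \<open>V\<close> and \<open>G\<close>, and after precomposition with \<open>lam\<close> from that
  of \<open>Rmap\<close>, \<open>G\<close> and \<open>T\<close>.\<close>

lemma H_functor: "cat_functor D D H"
proof (unfold_locales, goal_cases)
  case (1 x)
  then show ?case by (simp add: H_def Q_Ob)
next
  case (2 f x y)
  then show ?case by (simp add: H_def Qmap_hom)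
next
  case (3 P)
  note i = V.A.Ident_hom[OF 3] and iQ = V.A.Ident_hom[OF Q_Ob[OF 3]]
  have GR: "FOb G (R P) \<in> Ob C" using G.FOb_in[OF R_Ob[OF 3]] .
  have "Qmap (Ident D P) = Ident D (Q P)"
  proof (rule lam_unique[OF 3 Qmap_hom[OF i] iQ])
    show "FAr V (Qmap (Ident D P)) = FAr V (Ident D (Q P))"
      using V_Qmap[OF i] V.FAr_Ident[OF 3] V.FAr_Ident[OF Q_Ob[OF 3]] V_Q[OF 3]
        G.FAr_Ident[OF V.FOb_in[OF 3]] by simp
    show "Comp D (Qmap (Ident D P)) (lam P) = Comp D (Ident D (Q P)) (lam P)"
      using Qmap_lam[OF i] Rmap_Ident[OF 3] G.FAr_Ident[OF R_Ob[OF 3]] T.FAr_Ident[OF GR]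
        V.A.Comp_Ident[OF lam_hom[OF 3]] V.A.Ident_Comp[OF lam_hom[OF 3]] by simp
  qed
  then show ?case by (simp add: H_def)
next
  case (4 f x y g z)
  note f = 4(1) and g = 4(2)
  have x: "x \<in> Ob D" and y: "y \<in> Ob D" and z: "z \<in> Ob D" using f g V.A.hom_Ob by auto
  note gf = V.A.Comp_hom[OF f g] and Qf = Qmap_hom[OF f] and Qg = Qmap_hom[OF g]
  note Rf = Rmap_hom[OF f] and Rg = Rmap_hom[OF g]
  note GRf = G.FAr_hom[OF Rf] and GRg = G.FAr_hom[OF Rg]
  note TGRf = T.FAr_hom[OF GRf] and TGRg = T.FAr_hom[OF GRg]
  have "Qmap (Comp D g f) = Comp D (Qmap g) (Qmap f)"
  proof (rule lam_unique[OF x Qmap_hom[OF gf] V.A.Comp_hom[OF Qf Qg]])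
    show "FAr V (Qmap (Comp D g f)) = FAr V (Comp D (Qmap g) (Qmap f))"
      using V_Qmap[OF gf] V.FAr_Comp[OF f g] G.FAr_Comp[OF V.FAr_hom[OF f] V.FAr_hom[OF g]]
        V.FAr_Comp[OF Qf Qg] V_Qmap[OF f] V_Qmap[OF g] by simp
    have "Comp D (Comp D (Qmap g) (Qmap f)) (lam x)
        = Comp D (Comp D (Qmap g) (lam y)) (FAr T (FAr G (Rmap f)))"
      using V.A.Comp_assoc[OF lam_hom[OF x] Qf Qg] Qmap_lam[OF f]
        V.A.Comp_assoc[OF TGRf lam_hom[OF y] Qg] by simp
    also have "\<dots> = Comp D (lam z) (FAr T (Comp C (FAr G (Rmap g)) (FAr G (Rmap f))))"
      using Qmap_lam[OF g] V.A.Comp_assoc[OF TGRf TGRg lam_hom[OF z]] T.FAr_Comp[OF GRf GRg]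
      by simp
    also have "\<dots> = Comp D (Qmap (Comp D g f)) (lam x)"
      using Qmap_lam[OF gf] Rmap_Comp[OF f g] G.FAr_Comp[OF Rf Rg] by simp
    finally show "Comp D (Qmap (Comp D g f)) (lam x) = Comp D (Comp D (Qmap g) (Qmap f)) (lam x)"
      by simp
  qed
  then show ?case by (simp add: H_def)
qed

section \<open>Truth preservation of the lifting\<close>

definition psi :: "'o \<Rightarrow> 'n" where
  "psi X = (THE g. g \<in> hom D (Q (FOb T X)) (FOb T (FOb G X)) \<and> FAr V g = Ident C (FOb G X))"

text \<open>Since \<open>V (Q (T X)) = G X\<close>, the identity of \<open>G X\<close> has a unique
  lift from \<open>Q (T X)\<close> into the truth object; \<open>psi X\<close> is this vertical
  comparison.\<close>

lemma psi:
  assumes X: "X \<in> Ob C"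
  shows psi_hom: "psi X \<in> hom D (Q (FOb T X)) (FOb T (FOb G X))"
    and V_psi: "FAr V (psi X) = Ident C (FOb G X)"
proof -
  have P: "FOb T X \<in> Ob D" and GX: "FOb G X \<in> Ob C" using T.FOb_in[OF X] G.FOb_in[OF X] .
  have "Ident C (FOb G X) \<in> hom C (FOb V (Q (FOb T X))) (FOb G X)"
    using V_Q[OF P] VT_Ob[OF X] V.B.Ident_hom[OF GX] by simp
  from theI'[OF truth_lift[OF Q_Ob[OF P] this]]
  show "psi X \<in> hom D (Q (FOb T X)) (FOb T (FOb G X))" "FAr V (psi X) = Ident C (FOb G X)"
    by (simp_all add: psi_def)
qed

text \<open>The inverse of \<open>psi X\<close> is \<open>lam (T X)\<close> precomposed with the image of the unit, because the
  projection of \<open>T X\<close> is invertible.\<close>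

lemma psi_isomorphism:
  assumes X: "X \<in> Ob C"
  shows "isomorphism D (psi X)"
proof -
  let ?P = "FOb T X"
  have P: "?P \<in> Ob D" and GX: "FOb G X \<in> Ob C" using T.FOb_in[OF X] G.FOb_in[OF X] .
  note ph = psi_hom[OF X] and lh = lam_hom[OF P] and uh = unit_hom[OF X]
  note Gu = G.FAr_hom[OF uh]
  note TGu = T.FAr_hom[OF Gu]
  have pr: "proj ?P \<in> hom C (R ?P) X" using proj_hom[OF P] VT_Ob[OF X] by simp
  note Gp = G.FAr_hom[OF pr]
  note TGp = T.FAr_hom[OF Gp]
  define j where "j = Comp D (lam ?P) (FAr T (FAr G (unit X)))"
  have j: "j \<in> hom D (FOb T (FOb G X)) (Q ?P)" unfolding j_def using V.A.Comp_hom[OF TGu lh] .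
  have Vj: "FAr V j = Ident C (FOb G X)"
    unfolding j_def
    using V.FAr_Comp[OF TGu lh] V_lam[OF P] VT_Ar homD[OF Gu] G.FAr_Comp[OF uh pr]
      proj_unit[OF X] G.FAr_Ident[OF X] by (simp add: proj_def)
  have idid: "Comp C (Ident C (FOb G X)) (Ident C (FOb G X)) = Ident C (FOb G X)"
    using V.B.Ident_Comp[OF V.B.Ident_hom[OF GX]] .
  have 1: "Comp D (psi X) j = Ident D (FOb T (FOb G X))"
    by (rule truth_unique[OF GX V.A.Comp_hom[OF j ph] V.A.Ident_hom[OF T.FOb_in[OF GX]]])
      (use V.FAr_Comp[OF j ph] V_psi[OF X] Vj idid V.FAr_Ident[OF T.FOb_in[OF GX]] VT_Ob[OF GX]
        in simp)
  \<comment> \<open>\<open>psi X\<close> is vertical, so both sides lie above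
    \<open>G (proj ?P)\<close> and end in the truth object \<open>T (G X)\<close>. This reduces
    \<open>j\<close> after \<open>psi X\<close>, tested on \<open>lam ?P\<close>, to
    \<open>unit_proj\<close>.\<close>
  have pl: "Comp D (psi X) (lam ?P) = FAr T (FAr G (proj ?P))"
    by (rule truth_unique[OF GX V.A.Comp_hom[OF lh ph] TGp])
      (use V.FAr_Comp[OF lh ph] V_psi[OF X] V_lam[OF P] VT_Ar homD[OF Gp] V.B.Ident_Comp[OF Gp]
        in \<open>simp add: proj_def\<close>)
  have 2: "Comp D j (psi X) = Ident D (Q ?P)"
  proof (rule lam_unique[OF P V.A.Comp_hom[OF ph j] V.A.Ident_hom[OF Q_Ob[OF P]]])
    show "FAr V (Comp D j (psi X)) = FAr V (Ident D (Q ?P))"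
      using V.FAr_Comp[OF ph j] V_psi[OF X] Vj idid V.FAr_Ident[OF Q_Ob[OF P]] V_Q[OF P]
        VT_Ob[OF X] by simp
    have "Comp D (Comp D j (psi X)) (lam ?P) = Comp D j (FAr T (FAr G (proj ?P)))"
      using V.A.Comp_assoc[OF lh ph j] pl by simp
    also have "\<dots> = Comp D (lam ?P) (FAr T (FAr G (Comp C (unit X) (proj ?P))))"
      unfolding j_def using V.A.Comp_assoc[OF TGp TGu lh] T.FAr_Comp[OF Gp Gu] G.FAr_Comp[OF pr uh]
      by simp
    also have "\<dots> = lam ?P"
      using unit_proj[OF X] G.FAr_Ident[OF R_Ob[OF P]] T.FAr_Ident[OF G.FOb_in[OF R_Ob[OF P]]]
        V.A.Comp_Ident[OF lh] by simp
    finally show "Comp D (Comp D j (psi X)) (lam ?P) = Comp D (Ident D (Q ?P)) (lam ?P)"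
      using V.A.Ident_Comp[OF lh] by simp
  qed
  show ?thesis
    using homD[OF ph] j 1 2 by (auto simp: isomorphism_def)
qed

text \<open>Naturality comes from \<open>truth_unique\<close>: both composites end in the truth
  object \<open>T (G Y)\<close> and lie above \<open>G f\<close>.\<close>

lemma psi_natural_isomorphism: "natural_isomorphism C D (H \<circ>\<^sub>F T) (T \<circ>\<^sub>F G) psi"
  unfolding natural_isomorphism_def natural_transformation_def
proof (intro conjI ballI allI)
  show "cat_functor C D (H \<circ>\<^sub>F T)"
    using cat_functor_comp[OF T.cat_functor_axioms H_functor] .
  show "cat_functor C D (T \<circ>\<^sub>F G)"
    using cat_functor_comp[OF G.cat_functor_axioms T.cat_functor_axioms] .
  fix X assume "X \<in> Ob C"
  then show "psi X \<in> hom D (FOb (H \<circ>\<^sub>F T) X) (FOb (T \<circ>\<^sub>F G) X)" "isomorphism D (psi X)"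
    using psi_hom psi_isomorphism by (simp_all add: comp_fnctr_def H_def)
next
  fix X Y f assume f: "f \<in> hom C X Y"
  have X: "X \<in> Ob C" and Y: "Y \<in> Ob C" using f V.B.hom_Ob by auto
  note Tf = T.FAr_hom[OF f] and Gf = G.FAr_hom[OF f]
  note QTf = Qmap_hom[OF Tf] and TGf = T.FAr_hom[OF Gf]
  have "Comp D (psi Y) (Qmap (FAr T f)) = Comp D (FAr T (FAr G f)) (psi X)"
    by (rule truth_unique[OF G.FOb_in[OF Y] V.A.Comp_hom[OF QTf psi_hom[OF Y]]
          V.A.Comp_hom[OF psi_hom[OF X] TGf]])
      (use V.FAr_Comp[OF QTf psi_hom[OF Y]] V.FAr_Comp[OF psi_hom[OF X] TGf] V_psi[OF X] V_psi[OF Y]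
        V_Qmap[OF Tf] VT_Ar homD[OF f] homD[OF Gf] V.B.Ident_Comp[OF Gf] V.B.Comp_Ident[OF Gf]
        in simp)
  then show "Comp D (psi Y) (FAr (H \<circ>\<^sub>F T) f) = Comp D (FAr (T \<circ>\<^sub>F G) f) (psi X)"
    by (simp add: comp_fnctr_def H_def)
qed

lemma truth_preserving_lifting_H: "truth_preserving_lifting D C V T G H psi"
  unfolding truth_preserving_lifting_def fnctr_eq_def
  using H_functor psi_natural_isomorphism V_Q V_Qmap
  by (auto simp: comp_fnctr_def H_def hom_def)

end

section \<open>Slices\<close>

lemma hom_slice:
  "t \<in> hom (slice C I) p q \<longleftrightarrow> (\<exists>h. t = (p, h, q) \<and> p \<in> Ar C \<and> Cod C p = I \<and>
     q \<in> Ar C \<and> Cod C q = I \<and> h \<in> hom C (Dom C p) (Dom C q) \<and> Comp C q h = p)"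
  unfolding hom_def[of "slice C I"] by (auto simp: slice_def)

lemma Ob_slice: "p \<in> Ob (slice C I) \<longleftrightarrow> p \<in> hom C (Dom C p) I"
  by (auto simp: slice_def hom_def)

lemma Ident_slice: "Ident (slice C I) p = (p, Ident C (Dom C p), p)"
  by (simp add: slice_def)

lemma Comp_slice: "Comp (slice C I) (q', k, s) (p, h, q) = (p, Comp C k h, s)"
  by (simp add: slice_def)

lemma category_slice:
  assumes "category C"
  shows "category (slice C I)"
proof -
  interpret category C by fact
  show ?thesis
  proof (unfold_locales, goal_cases)
    case (1 f) then show ?case by (auto simp: slice_def)
  next
    case (2 f) then show ?case by (auto simp: slice_def)
  next
    case (3 x)
    then have x: "x \<in> hom C (Dom C x) I" by (simp add: Ob_slice)
    then have "Ident C (Dom C x) \<in> hom C (Dom C x) (Dom C x)" using Ident_hom hom_Ob by blast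
    then show ?case using Comp_Ident[OF x] homD[OF x] by (simp add: hom_slice Ident_slice)
  next
    case (4 f x y g z)
    then obtain h k where f: "f = (x, h, y)" and g: "g = (y, k, z)"
      and h: "h \<in> hom C (Dom C x) (Dom C y)" and k: "k \<in> hom C (Dom C y) (Dom C z)"
      and xy: "x \<in> Ar C" "Cod C x = I" "z \<in> Ar C" "Cod C z = I" "Comp C y h = x" "Comp C z k = y"
      by (auto simp: hom_slice)
    have "Comp C z (Comp C k h) = x"
      using Comp_assoc[OF h k homI[OF xy(3) refl xy(4)]] xy by simp
    then show ?case using f g xy Comp_hom[OF h k] by (simp add: hom_slice Comp_slice)
  next
    case (5 f x y) then show ?case by (auto simp: hom_slice Comp_slice Ident_slice Comp_Ident)
  next
    case (6 f x y) then show ?case by (auto simp: hom_slice Comp_slice Ident_slice Ident_Comp)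
  next
    case (7 f w x g y h z)
    then show ?case by (auto simp: hom_slice Comp_slice intro: Comp_assoc)
  qed
qed

lemma slice_fnctr_simps:
  "FOb (slice_fnctr F) p = FAr F p" "FAr (slice_fnctr F) (p, h, q) = (FAr F p, FAr F h, FAr F q)"
  by (simp_all add: slice_fnctr_def)

text \<open>The base point is given by the equation \<open>F J = I\<close>, so that \<open>V\<close>
  on the slice over \<open>T I\<close> can have the slice over \<open>I\<close> as target, using
  \<open>V (T I) = I\<close>.\<close>

lemma cat_functor_slice:
  assumes "cat_functor A B F" "FOb F J = I"
  shows "cat_functor (slice A J) (slice B I) (slice_fnctr F)"
proof -
  interpret cat_functor A B F by fact
  interpret SA: category "slice A J" by (rule category_slice[OF A.category_axioms])
  interpret SB: category "slice B I" by (rule category_slice[OF B.category_axioms])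
  have ar: "FAr F p \<in> Ar B \<and> Cod B (FAr F p) = I \<and> Dom B (FAr F p) = FOb F (Dom A p)"
    if "p \<in> Ar A" "Cod A p = J" for p
    using homD[OF FAr_hom[OF homI[OF that(1) refl that(2)]]] assms(2) by simp
  show ?thesis
  proof (unfold_locales, goal_cases)
    case (1 x)
    then show ?case using ar by (simp add: slice_def slice_fnctr_def)
  next
    case (2 f x y)
    then obtain h where f: "f = (x, h, y)" and h: "h \<in> hom A (Dom A x) (Dom A y)"
      and xy: "x \<in> Ar A" "Cod A x = J" "y \<in> Ar A" "Cod A y = J" "Comp A y h = x"
      by (auto simp: hom_slice)
    have "Comp B (FAr F y) (FAr F h) = FAr F x"
      using FAr_Comp[OF h homI[OF xy(3) refl xy(4)]] xy(5) by simp
    then show ?case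
      using f ar[OF xy(1,2)] ar[OF xy(3,4)] FAr_hom[OF h] by (simp add: hom_slice slice_fnctr_simps)
  next
    case (3 x)
    then have "x \<in> Ar A" "Cod A x = J" by (auto simp: slice_def)
    then show ?case
      using ar A.Dom_in by (simp add: Ident_slice slice_fnctr_simps FAr_Ident)
  next
    case (4 f x y g z)
    then show ?case by (auto simp: hom_slice Comp_slice slice_fnctr_simps FAr_Comp)
  qed
qed

section \<open>Lawvere categories\<close>

text \<open>Cartesianness in the opposite categories, spelled out with both ends explicit; the
  universal property then has the shape of \<open>lam_universal\<close>.\<close>

definition (in cat_functor) opcartesian :: "'m \<Rightarrow> 'o \<Rightarrow> 'o \<Rightarrow> bool" where
  "opcartesian g P Q \<longleftrightarrow> g \<in> hom A P Q \<and>
     (\<forall>Q'. \<forall>g' \<in> hom A P Q'. \<forall>v \<in> hom B (FOb F Q) (FOb F Q').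
        FAr F g' = Comp B v (FAr F g) \<longrightarrow>
        (\<exists>!h. h \<in> hom A Q Q' \<and> FAr F h = v \<and> Comp A h g = g'))"

lemma hom_op_cat: "hom (op_cat C) x y = hom C y x"
  by (auto simp: hom_def op_cat_def)

lemma opfibration_opcartesian:
  assumes "cat_functor E B U" "opfibration E B U" "P \<in> Ob E" "f \<in> hom B (FOb U P) Y"
  shows "\<exists>Q g. cat_functor.opcartesian E B U g P Q \<and> FAr U g = f"
proof -
  interpret cat_functor E B U by fact
  have "f \<in> Ar (op_cat B)" "Cod (op_cat B) f = FOb U P" "P \<in> Ob (op_cat E)"
    using assms(3,4) by (auto simp: op_cat_def hom_def)
  then obtain g where g: "cartesian (op_cat E) (op_cat B) U f g" "Cod (op_cat E) g = P"
    using assms(2) unfolding opfibration_def fibration_def by blast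
  have gh: "g \<in> hom E P (Cod E g)" and Ug: "FAr U g = f"
    using g by (auto simp: cartesian_def op_cat_def hom_def)
  \<comment> \<open>\<open>cartesian\<close> types the base morphism by the codomain of
    \<open>f\<close>, \<open>opcartesian\<close> by the image of the codomain of
    \<open>g\<close>.\<close>
  have cod: "FOb U (Cod E g) = Cod B f" using homD[OF FAr_hom[OF gh]] Ug by simp
  have "opcartesian g P (Cod E g)"
    unfolding opcartesian_def
  proof (intro conjI allI ballI impI)
    show "g \<in> hom E P (Cod E g)" by (rule gh)
    fix Q' g' v
    assume "g' \<in> hom E P Q'" "v \<in> hom B (FOb U (Cod E g)) (FOb U Q')"
      "FAr U g' = Comp B v (FAr U g)"
    then show "\<exists>!h. h \<in> hom E (Cod E g) Q' \<and> FAr U h = v \<and> Comp E h g = g'"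
      using g Ug cod unfolding cartesian_def hom_op_cat
      by (simp add: op_cat_def)
  qed
  then show ?thesis using Ug by blast
qed

text \<open>Take a cartesian \<open>c\<close> above \<open>f\<close> with codomain
  \<open>K X\<close>. Reindexing preserves terminal objects, so the domain of \<open>c\<close> is
  terminal in the fibre over \<open>U P\<close>. Morphisms from \<open>P\<close> to
  \<open>K X\<close> above \<open>f\<close> are the composites of \<open>c\<close> with a vertical
  morphism into this terminal object, of which there is exactly one.\<close>

lemma truth_functor_lift:
  assumes fib: "fibration E B U" and K: "truth_functor E B U K"
    and P: "P \<in> Ob E" and f: "f \<in> hom B (FOb U P) X"
  shows "\<exists>!g. g \<in> hom E P (FOb K X) \<and> FAr U g = f"
proof -
  interpret U: cat_functor E B U using fib by (simp add: fibration_def)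
  interpret K: cat_functor B E K using K by (simp add: truth_functor_def)
  have X: "X \<in> Ob B" and UP: "FOb U P \<in> Ob B" using U.B.hom_Ob[OF f] by auto
  have KX: "FOb K X \<in> Ob E" "FOb U (FOb K X) = X"
    using K.FOb_in[OF X] K X by (auto simp: truth_functor_def fnctr_eq_def comp_fnctr_def id_fnctr_def)
  obtain c where c: "cartesian E B U f c" "Cod E c = FOb K X"
    using fib KX homD[OF f] unfolding fibration_def by metis
  have ch: "c \<in> hom E (Dom E c) (FOb K X)" and Uc: "FAr U c = f"
    using c by (auto simp: cartesian_def hom_def)
  have top: "terminal (fibre E B U (FOb U P)) (Dom E c)"
    using K c homD[OF f] X unfolding truth_functor_def by metis
  have i: "Ident B (FOb U P) \<in> hom B (FOb U P) (FOb U P)" using U.B.Ident_hom[OF UP] .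
  have fi: "Comp B f (Ident B (FOb U P)) = f" using U.B.Comp_Ident[OF f] .
  have vert: "\<exists>!h. h \<in> hom E P (Dom E c) \<and> FAr U h = Ident B (FOb U P)"
  proof -
    have "P \<in> Ob (fibre E B U (FOb U P))" using P by (simp add: fibre_def)
    then have "\<exists>!h. h \<in> hom (fibre E B U (FOb U P)) P (Dom E c)"
      using top by (simp add: terminal_def)
    moreover have "h \<in> hom (fibre E B U (FOb U P)) P (Dom E c) \<longleftrightarrow>
        h \<in> hom E P (Dom E c) \<and> FAr U h = Ident B (FOb U P)" for h
      by (auto simp: hom_def fibre_def)
    ultimately show ?thesis by simp
  qed
  have factor: "\<exists>!h. h \<in> hom E P (Dom E c) \<and> FAr U h = Ident B (FOb U P) \<and> Comp E c h = g"
    if "g \<in> hom E P (FOb K X)" "FAr U g = f" for g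
    using c i fi that homD[OF f] unfolding cartesian_def by simp
  from vert obtain h where h: "h \<in> hom E P (Dom E c)" "FAr U h = Ident B (FOb U P)" by blast
  show ?thesis
  proof (intro ex1I conjI)
    show "Comp E c h \<in> hom E P (FOb K X)" using U.A.Comp_hom[OF h(1) ch] .
    show "FAr U (Comp E c h) = f" using U.FAr_Comp[OF h(1) ch] Uc h(2) fi by simp
    fix g assume "g \<in> hom E P (FOb K X) \<and> FAr U g = f"
    then show "g = Comp E c h" using factor[of g] vert h by metis
  qed
qed

text \<open>The counit of the adjunction supplies the universal arrows. The transpose of
  \<open>f\<close> is \<open>S f\<close> after \<open>\<eta> X\<close>; one triangle identity shows
  that it is a transpose, the other that it is the only one.\<close>

lemma lawvere_truth_comprehension:
  assumes "lawvere_category E B U K"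
  shows "\<exists>R e. truth_comprehension E B U K R e"
proof -
  have fib: "fibration E B U" and K: "truth_functor E B U K"
    and adj: "has_right_adjoint B E K"
    using assms by (auto simp: lawvere_category_def ccu_def)
  obtain S \<eta> \<epsilon> where S: "adjunction B E K S \<eta> \<epsilon>" using adj by (auto simp: has_right_adjoint_def)
  interpret U: cat_functor E B U using fib by (simp add: fibration_def)
  interpret K: cat_functor B E K using K by (simp add: truth_functor_def)
  interpret S: cat_functor E B S using S by (simp add: adjunction_def)
  have \<eta>: "\<eta> X \<in> hom B X (FOb S (FOb K X))" if "X \<in> Ob B" for X
    using S that by (simp add: adjunction_def natural_transformation_def comp_fnctr_def id_fnctr_def)
  have \<epsilon>: "\<epsilon> P \<in> hom E (FOb K (FOb S P)) P" if "P \<in> Ob E" for P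
    using S that by (simp add: adjunction_def natural_transformation_def comp_fnctr_def id_fnctr_def)
  have \<eta>_nat: "Comp B (\<eta> Y) f = Comp B (FAr S (FAr K f)) (\<eta> X)" if "f \<in> hom B X Y" for f X Y
    using S that by (simp add: adjunction_def natural_transformation_def comp_fnctr_def id_fnctr_def)
  have \<epsilon>_nat: "Comp E (\<epsilon> Q) (FAr K (FAr S f)) = Comp E f (\<epsilon> P)" if "f \<in> hom E P Q" for f P Q
    using S that by (simp add: adjunction_def natural_transformation_def comp_fnctr_def id_fnctr_def)
  have tri1: "Comp E (\<epsilon> (FOb K X)) (FAr K (\<eta> X)) = Ident E (FOb K X)" if "X \<in> Ob B" for X
    using S that by (simp add: adjunction_def)
  have tri2: "Comp B (FAr S (\<epsilon> P)) (\<eta> (FOb S P)) = Ident B (FOb S P)" if "P \<in> Ob E" for P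
    using S that by (simp add: adjunction_def)
  have "truth_comprehension E B U K (FOb S) \<epsilon>"
  proof (unfold_locales, goal_cases)
    case (1 X)
    then show ?case using K by (simp add: truth_functor_def fnctr_eq_def comp_fnctr_def id_fnctr_def)
  next
    case (2 f)
    then show ?case using K by (simp add: truth_functor_def fnctr_eq_def comp_fnctr_def id_fnctr_def)
  next
    case (3 P f X)
    then show ?case using truth_functor_lift[OF fib K] by blast
  next
    case (4 P)
    then show ?case by (rule \<epsilon>)
  next
    case (5 P)
    then show ?case by (rule S.FOb_in)
  next
    case (6 P X f)
    note P = 6(1) and X = 6(2) and f = 6(3)
    note Sf = S.FAr_hom[OF f] and KX = K.FOb_in[OF X]
    show ?case
    proof (intro ex1I conjI)
      show "Comp B (FAr S f) (\<eta> X) \<in> hom B X (FOb S P)" using U.B.Comp_hom[OF \<eta>[OF X] Sf] .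
      show "Comp E (\<epsilon> P) (FAr K (Comp B (FAr S f) (\<eta> X))) = f"
        using K.FAr_Comp[OF \<eta>[OF X] Sf]
          U.A.Comp_assoc[OF K.FAr_hom[OF \<eta>[OF X]] K.FAr_hom[OF Sf] \<epsilon>[OF P]] \<epsilon>_nat[OF f]
          U.A.Comp_assoc[OF K.FAr_hom[OF \<eta>[OF X]] \<epsilon>[OF KX] f] tri1[OF X] U.A.Comp_Ident[OF f]
        by simp
      fix k assume k: "k \<in> hom B X (FOb S P) \<and> Comp E (\<epsilon> P) (FAr K k) = f"
      then have kh: "k \<in> hom B X (FOb S P)" by simp
      note SP = S.FOb_in[OF P] and Kk = K.FAr_hom[OF kh]
      have "Comp B (FAr S f) (\<eta> X) = Comp B (FAr S (\<epsilon> P)) (Comp B (FAr S (FAr K k)) (\<eta> X))"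
        using k S.FAr_Comp[OF Kk \<epsilon>[OF P]]
          U.B.Comp_assoc[OF \<eta>[OF X] S.FAr_hom[OF Kk] S.FAr_hom[OF \<epsilon>[OF P]]] by simp
      also have "\<dots> = Comp B (Comp B (FAr S (\<epsilon> P)) (\<eta> (FOb S P))) k"
        using \<eta>_nat[OF kh] U.B.Comp_assoc[OF kh \<eta>[OF SP] S.FAr_hom[OF \<epsilon>[OF P]]] by simp
      also have "\<dots> = k" using tri2[OF P] U.B.Ident_Comp[OF kh] by simp
      finally show "k = Comp B (FAr S f) (\<eta> X)" by simp
    qed
  qed
  then show ?thesis by blast
qed

section \<open>Passage to slices and existence of the sound lifting\<close>

context truth_comprehension
begin

text \<open>Both \<open>q\<close> after \<open>h\<close> and \<open>p\<close> end in the truth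
  object \<open>T I\<close>, so \<open>truth_unique\<close> applies.\<close>

lemma slice_cone:
  assumes "I \<in> Ob C" "p \<in> hom D P (FOb T I)" "q \<in> hom D P' (FOb T I)" "h \<in> hom D P P'"
  shows "Comp D q h = p \<longleftrightarrow> Comp C (FAr V q) (FAr V h) = FAr V p"
  using truth_unique[OF assms(1) V.A.Comp_hom[OF assms(4,3)] assms(2)] V.FAr_Comp[OF assms(4,3)]
  by auto

text \<open>The properties of \<open>V\<close> are applied to middle components; what has to be
  added is that the resulting morphisms commute with the structure maps.\<close>

lemma truth_comprehension_slice:
  assumes I: "I \<in> Ob C"
  defines "R' \<equiv> \<lambda>p. Comp C (FAr V p) (proj (Dom D p))"
  shows "truth_comprehension (slice D (FOb T I)) (slice C I) (slice_fnctr V) (slice_fnctr T)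
    R' (\<lambda>p. (FAr T (R' p), e (Dom D p), p))"
proof -
  interpret SV: cat_functor "slice D (FOb T I)" "slice C I" "slice_fnctr V"
    by (rule cat_functor_slice[OF V.cat_functor_axioms VT_Ob[OF I]])
  interpret ST: cat_functor "slice C I" "slice D (FOb T I)" "slice_fnctr T"
    by (rule cat_functor_slice[OF T.cat_functor_axioms refl])
  have Vp: "FAr V p \<in> hom C (FOb V P) I" if "p \<in> hom D P (FOb T I)" for p P
    using V.FAr_hom[OF that] VT_Ob[OF I] by simp
  have R': "R' p \<in> hom C (R P) I" if p: "p \<in> hom D P (FOb T I)" for p P
    unfolding R'_def using V.B.Comp_hom[OF proj_hom Vp[OF p]] V.A.hom_Ob[OF p] homD[OF p] by simp
  \<comment> \<open>This triangle makes \<open>e P\<close> a morphism of the slice from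
    \<open>T (R' p)\<close> to \<open>p\<close>. It follows from \<open>slice_cone\<close>, as
    \<open>R' p\<close> is by definition the image of the left side under \<open>V\<close>.\<close>
  have TR': "Comp D p (e P) = FAr T (R' p)" if p: "p \<in> hom D P (FOb T I)" for p P
  proof -
    have P: "P \<in> Ob D" using V.A.hom_Ob[OF p] by simp
    show ?thesis
      unfolding slice_cone[OF I T.FAr_hom[OF R'[OF p]] p e_hom[OF P]]
      using VT_Ar homD[OF R'[OF p]] homD[OF p] by (simp add: R'_def proj_def)
  qed
  show ?thesis
  proof (unfold_locales, goal_cases)
    case (1 X)
    then show ?case by (auto simp: slice_def slice_fnctr_def VT_Ar)
  next
    case (2 f)
    then show ?case by (auto simp: slice_def slice_fnctr_def VT_Ar hom_def)
  next
    case (3 p f x)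
    then have p: "p \<in> hom D (Dom D p) (FOb T I)" by (simp add: Ob_slice)
    note Vp' = Vp[OF p]
    obtain h where f: "f = (FAr V p, h, x)" and h: "h \<in> hom C (FOb V (Dom D p)) (Dom C x)"
      and x: "x \<in> hom C (Dom C x) I" and xh: "Comp C x h = FAr V p"
      using 3(2) homD[OF Vp'] by (auto simp: hom_slice slice_fnctr_simps intro: homI)
    note Tx = T.FAr_hom[OF x]
    have P: "Dom D p \<in> Ob D" using V.A.hom_Ob[OF p] by simp
    have "t \<in> hom (slice D (FOb T I)) p (FAr T x) \<and> FAr (slice_fnctr V) t = f \<longleftrightarrow>
        (\<exists>g. t = (p, g, FAr T x) \<and> g \<in> hom D (Dom D p) (FOb T (Dom C x)) \<and> FAr V g = h)" for t
      using f p homD[OF p] homD[OF Tx] homD[OF x] VT_Ar xh slice_cone[OF I p Tx]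
      by (auto simp: hom_slice slice_fnctr_simps)
    then show ?case using truth_lift[OF P h] by (simp only: slice_fnctr_simps ex1_triple)
  next
    case (4 p)
    then have p: "p \<in> hom D (Dom D p) (FOb T I)" by (simp add: Ob_slice)
    have P: "Dom D p \<in> Ob D" using V.A.hom_Ob[OF p] by simp
    then show ?case
      using homD[OF p] homD[OF T.FAr_hom[OF R'[OF p]]] e_hom[OF P] TR'[OF p]
      by (simp add: hom_slice slice_fnctr_simps)
  next
    case (5 p)
    then have p: "p \<in> hom D (Dom D p) (FOb T I)" by (simp add: Ob_slice)
    then show ?case using R'[OF p] homD[OF R'[OF p]] by (simp add: Ob_slice)
  next
    case (6 p x f)
    then have p: "p \<in> hom D (Dom D p) (FOb T I)" and x: "x \<in> hom C (Dom C x) I"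
      by (simp_all add: Ob_slice)
    have P: "Dom D p \<in> Ob D" and X: "Dom C x \<in> Ob C"
      using V.A.hom_Ob[OF p] V.B.hom_Ob[OF x] by auto
    note Tx = T.FAr_hom[OF x] and R'p = R'[OF p] and eP = e_hom[OF P]
    obtain h where f: "f = (FAr T x, h, p)" and h: "h \<in> hom D (FOb T (Dom C x)) (Dom D p)"
      and ph: "Comp D p h = FAr T x"
      using 6(3) homD[OF Tx] by (auto simp: hom_slice slice_fnctr_simps)
    \<comment> \<open>The transpose \<open>k\<close> is automatically a morphism over
      \<open>I\<close>: by \<open>TR'\<close>, \<open>R' p\<close> after \<open>k\<close> and
      \<open>x\<close> have the same image under \<open>T\<close>, and \<open>V\<close> recovers
      them from it.\<close>
    have over: "Comp C (R' p) k = x"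
      if k: "k \<in> hom C (Dom C x) (R (Dom D p))" and eq: "Comp D (e (Dom D p)) (FAr T k) = h" for k
    proof -
      note Tk = T.FAr_hom[OF k]
      have "FAr T (Comp C (R' p) k) = Comp D (Comp D p (e (Dom D p))) (FAr T k)"
        using T.FAr_Comp[OF k R'p] TR'[OF p] by simp
      also have "\<dots> = FAr T x"
        using V.A.Comp_assoc[OF Tk eP p] eq ph by simp
      finally have "FAr V (FAr T (Comp C (R' p) k)) = FAr V (FAr T x)" by simp
      then show ?thesis using VT_Ar homD[OF V.B.Comp_hom[OF k R'p]] homD[OF x] by simp
    qed
    have "t \<in> hom (slice C I) x (R' p) \<and>
        Comp (slice D (FOb T I)) (FAr T (R' p), e (Dom D p), p) (FAr (slice_fnctr T) t) = f \<longleftrightarrow>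
        (\<exists>k. t = (x, k, R' p) \<and> k \<in> hom C (Dom C x) (R (Dom D p)) \<and>
          Comp D (e (Dom D p)) (FAr T k) = h)" for t
    proof
      assume "t \<in> hom (slice C I) x (R' p) \<and>
        Comp (slice D (FOb T I)) (FAr T (R' p), e (Dom D p), p) (FAr (slice_fnctr T) t) = f"
      then show "\<exists>k. t = (x, k, R' p) \<and> k \<in> hom C (Dom C x) (R (Dom D p)) \<and>
          Comp D (e (Dom D p)) (FAr T k) = h"
        using f homD[OF R'p] by (auto simp: hom_slice slice_fnctr_simps Comp_slice)
    next
      assume "\<exists>k. t = (x, k, R' p) \<and> k \<in> hom C (Dom C x) (R (Dom D p)) \<and>
          Comp D (e (Dom D p)) (FAr T k) = h"
      then obtain k where t: "t = (x, k, R' p)" and k: "k \<in> hom C (Dom C x) (R (Dom D p))"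
        and eq: "Comp D (e (Dom D p)) (FAr T k) = h" by blast
      show "t \<in> hom (slice C I) x (R' p) \<and>
        Comp (slice D (FOb T I)) (FAr T (R' p), e (Dom D p), p) (FAr (slice_fnctr T) t) = f"
        using t k eq f homD[OF x] homD[OF R'p] over[OF k eq]
        by (simp add: hom_slice slice_fnctr_simps Comp_slice)
    qed
    then show ?case using e_universal[OF P X h] by (simp only: ex1_triple)
  qed
qed

text \<open>The middle component is an opcartesian lift \<open>g\<close> of the middle component of
  \<open>f\<close>. Its codomain \<open>Q\<close> gets as structure map the lift \<open>q\<close> of
  \<open>y\<close> into \<open>T I\<close>, and factorizations through \<open>g\<close> commute with
  the structure maps by \<open>slice_cone\<close>.\<close>

lemma opcartesian_slice:
  assumes I: "I \<in> Ob C" and opf: "opfibration D C V"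
    and p: "p \<in> Ob (slice D (FOb T I))"
    and f: "f \<in> hom (slice C I) (FOb (slice_fnctr V) p) y"
  shows "\<exists>q g. cat_functor.opcartesian (slice D (FOb T I)) (slice C I) (slice_fnctr V) g p q \<and>
    FAr (slice_fnctr V) g = f"
proof -
  interpret SV: cat_functor "slice D (FOb T I)" "slice C I" "slice_fnctr V"
    by (rule cat_functor_slice[OF V.cat_functor_axioms VT_Ob[OF I]])
  let ?P = "Dom D p"
  have ph: "p \<in> hom D ?P (FOb T I)" using p by (simp add: Ob_slice)
  have P: "?P \<in> Ob D" using V.A.hom_Ob[OF ph] by simp
  have Vp: "FAr V p \<in> hom C (FOb V ?P) I" using V.FAr_hom[OF ph] VT_Ob[OF I] by simp
  obtain h where f_eq: "f = (FAr V p, h, y)" and h: "h \<in> hom C (FOb V ?P) (Dom C y)"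
    and y: "y \<in> hom C (Dom C y) I" and yh: "Comp C y h = FAr V p"
    using f homD[OF Vp] by (auto simp: hom_slice slice_fnctr_simps intro: homI)
  obtain Q g where g: "V.opcartesian g ?P Q" and Vg: "FAr V g = h"
    using opfibration_opcartesian[OF V.cat_functor_axioms opf P h] by blast
  have gh: "g \<in> hom D ?P Q" using g by (simp add: V.opcartesian_def)
  have VQ: "FOb V Q = Dom C y" using homD[OF V.FAr_hom[OF gh]] homD[OF h] Vg by simp
  have Q: "Q \<in> Ob D" using V.A.hom_Ob[OF gh] by simp
  obtain q where qh: "q \<in> hom D Q (FOb T I)" and Vq: "FAr V q = y"
    using truth_lift[OF Q, of y I] y VQ by auto
  have qg: "Comp D q g = p" using slice_cone[OF I ph qh gh] Vq Vg yh by simp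
  have "SV.opcartesian (p, g, q) p q"
    unfolding SV.opcartesian_def
  proof (intro conjI allI ballI impI)
    show "(p, g, q) \<in> hom (slice D (FOb T I)) p q"
      using homD[OF ph] homD[OF qh] gh qg by (simp add: hom_slice)
    fix q' g' v
    assume g': "g' \<in> hom (slice D (FOb T I)) p q'"
      and v: "v \<in> hom (slice C I) (FOb (slice_fnctr V) q) (FOb (slice_fnctr V) q')"
      and eq: "FAr (slice_fnctr V) g' = Comp (slice C I) v (FAr (slice_fnctr V) (p, g, q))"
    obtain k where g'_eq: "g' = (p, k, q')" and k: "k \<in> hom D ?P (Dom D q')"
      and q': "q' \<in> hom D (Dom D q') (FOb T I)"
      using g' by (auto simp: hom_slice intro: homI)
    have Vq': "FAr V q' \<in> hom C (FOb V (Dom D q')) I"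
      using V.FAr_hom[OF q'] VT_Ob[OF I] by simp
    obtain w where v_eq: "v = (y, w, FAr V q')"
      and w: "w \<in> hom C (FOb V Q) (FOb V (Dom D q'))" and q'w: "Comp C (FAr V q') w = y"
      using v Vq VQ homD[OF Vq'] by (auto simp: hom_slice slice_fnctr_simps)
    have "FAr V k = Comp C w (FAr V g)"
      using eq by (simp add: g'_eq v_eq slice_fnctr_simps Comp_slice)
    then have "\<exists>!u. u \<in> hom D Q (Dom D q') \<and> FAr V u = w \<and> Comp D u g = k"
      using g k w unfolding V.opcartesian_def by blast
    \<comment> \<open>The triangle required of \<open>u\<close> holds because its image in the base
      is \<open>q'w\<close>.\<close>
    moreover have "t \<in> hom (slice D (FOb T I)) q q' \<and> FAr (slice_fnctr V) t = v \<and>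
        Comp (slice D (FOb T I)) t (p, g, q) = g' \<longleftrightarrow>
        (\<exists>u. t = (q, u, q') \<and> u \<in> hom D Q (Dom D q') \<and> FAr V u = w \<and> Comp D u g = k)" for t
      using g'_eq v_eq homD[OF qh] homD[OF q'] slice_cone[OF I qh q'] Vq q'w
      by (auto simp: hom_slice slice_fnctr_simps Comp_slice)
    ultimately show "\<exists>!h. h \<in> hom (slice D (FOb T I)) q q' \<and> FAr (slice_fnctr V) h = v \<and>
        Comp (slice D (FOb T I)) h (p, g, q) = g'"
      by (simp only: ex1_triple)
  qed
  moreover have "FAr (slice_fnctr V) (p, g, q) = f"
    by (simp add: f_eq slice_fnctr_simps Vg Vq)
  ultimately show ?thesis by blast
qed

text \<open>Choosing for every \<open>P\<close> an opcartesian morphism above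
  \<open>G (proj P)\<close> out of \<open>T (G (R P))\<close> provides the data of
  \<open>truth_lifting\<close>; soundness is then an instance of
  \<open>lifting_sound\<close>.\<close>

lemma sound_lifting_exists:
  assumes G: "cat_functor C C G"
    and opcart: "\<And>P f Y. P \<in> Ob D \<Longrightarrow> f \<in> hom C (FOb V P) Y \<Longrightarrow>
      \<exists>Q g. V.opcartesian g P Q \<and> FAr V g = f"
  shows "\<exists>H \<psi>. truth_preserving_lifting D C V T G H \<psi> \<and> sound_induction_rule D C T G H \<psi>"
proof -
  interpret G: cat_functor C C G by (rule G)
  have Gp: "FAr G (proj P) \<in> hom C (FOb G (R P)) (FOb G (FOb V P))" if "P \<in> Ob D" for P
    using G.FAr_hom[OF proj_hom[OF that]] .
  have "\<exists>Q g. V.opcartesian g (FOb T (FOb G (R P))) Q \<and> FAr V g = FAr G (proj P)"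
    if P: "P \<in> Ob D" for P
    using opcart[OF T.FOb_in] VT_Ob G.FOb_in[OF R_Ob[OF P]] Gp[OF P] by metis
  then obtain Q lam where lam: "\<And>P. P \<in> Ob D \<Longrightarrow> V.opcartesian (lam P) (FOb T (FOb G (R P))) (Q P)"
    and V_lam: "\<And>P. P \<in> Ob D \<Longrightarrow> FAr V (lam P) = FAr G (proj P)"
    by metis
  interpret truth_lifting D C V T R e G Q lam
  proof (unfold_locales, goal_cases)
    case (1 P)
    then show ?case using lam by (simp add: V.opcartesian_def)
  next
    case (2 P)
    then show ?case using V_lam by (simp add: proj_def)
  next
    case (3 P k P' v)
    have "lam P \<in> hom D (FOb T (FOb G (R P))) (Q P)" using lam[OF 3(1)] by (simp add: V.opcartesian_def)
    from V.FAr_hom[OF this] have "FOb V (Q P) = FOb G (FOb V P)"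
      using V_lam[OF 3(1)] homD[OF Gp[OF 3(1)]] by (simp add: hom_def)
    then show ?case
      using lam[OF 3(1)] 3 V_lam[OF 3(1)] unfolding V.opcartesian_def proj_def by simp
  qed
  show ?thesis
    using truth_preserving_lifting_H lifting_sound[OF G] by blast
qed

end

theorem theorem4p8:
  fixes E :: "('p, 'n) cat" and B :: "('o, 'm) cat"
    and U :: "('p, 'n, 'o, 'm) fnctr" and K :: "('o, 'm, 'p, 'n) fnctr"
    and I :: 'o
    and F :: "('m, 'm \<times> 'm \<times> 'm, 'm, 'm \<times> 'm \<times> 'm) fnctr"
    and muF :: 'm and inF :: "'m \<times> 'm \<times> 'm"
  assumes "lawvere_category E B U K"
    and "I \<in> Ob B"
    and "cat_functor (slice B I) (slice B I) F"
    and "initial (alg_cat (slice B I) F) (muF, inF)"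
  shows "\<exists>Fhat \<psi>.
    truth_preserving_lifting (slice E (FOb K I)) (slice B I)
      (slice_fnctr U) (slice_fnctr K) F Fhat \<psi> \<and>
    sound_induction_rule (slice E (FOb K I)) (slice B I) (slice_fnctr K) F Fhat \<psi>"
proof -
  obtain R e where "truth_comprehension E B U K R e"
    using lawvere_truth_comprehension[OF assms(1)] by blast
  then interpret truth_comprehension E B U K R e .
  have opf: "opfibration E B U"
    using assms(1) by (simp add: lawvere_category_def bifibration_def)
  show ?thesis
    \<comment> \<open>The construction is carried out in the slice over \<open>I\<close>, with
      \<open>F\<close> as the base endofunctor; truth, comprehension and opcartesian lifts there
      come from those of \<open>U\<close>.\<close>
    by (rule truth_comprehension.sound_lifting_exists[OF truth_comprehension_slice[OF assms(2)] assms(3)])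
      (rule opcartesian_slice[OF assms(2) opf])
qed

end
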